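(* Let $(\mathbb{A},\star)$ be an $n$-dimensional ($n\ge1$) left-symmetric algebra over a field of characteristic zero with a Koszul form $\lambda$ with associated Hessian metric $h$. The idempotent $u$ associated with $\lambda$ has the following properties. (1) $L(u)$ and $R(u)$ preserve the Lie ideal $\ker\lambda=\langle u\rangle^{\perp}$. (2) $L(u)+L(u)^{*}=R(u)+I$. (3) $R(u)$ is $h$-self-adjoint, $R(u)=R(u)^{*}$. (4) $R(u)-R(u)^2$ is nilpotent, and there is an integer $k$ such that $1\le\operatorname{tr}R(u)=\dim\mathbb{A}_1=k\le n$ and $(R(u)-R(u)^2)^{\max\{k,n-k\}}=0$, where $\mathbb{A}_1=\bigcap_{j\ge1}R(u)^j\mathbb{A}$. (5) $\sum_{k\ge1}\ker R(u)^k\subset\ker\lambda$. (6) No nontrivial left ideal of $(\mathbb{A},\star)$ is contained in $\ker\lambda$. (7) $\ker R(u)\subset\ker\lambda$ is a Lie subalgebra of $\mathbb{A}$ on which $L(u)$ acts as a Lie algebra derivation.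
   Context: A left-symmetric algebra is a vector space $\mathbb{A}$ with a bilinear product $\star$ such that $[a,b]=a\star b-b\star a$ is a Lie bracket and $L([a,b])=[L(a),L(b)]$, where $L(a)b=a\star b$. Write $R(a)b=b\star a$. A Koszul form is $\lambda\in\mathbb{A}^*$ such that $h(x,y)=\lambda(x\star y)$ is a metric, i.e. a nondegenerate symmetric bilinear form (it is then automatically Hessian, meaning $h([x,y],z)=h(x,y\star z)-h(y,x\star z)$). The element $u\in\mathbb{A}$ determined by $\lambda(a)=\lambda(a\star u)=h(a,u)$ for all $a\in\mathbb{A}$ is idempotent and is called the idempotent associated with $\lambda$. $A^*$ denotes the $h$-adjoint of $A\in\operatorname{End}(\mathbb{A})$, $h(Ax,y)=h(x,A^*y)$; $\perp$ denotes $h$-orthogonal complement; $\langle u\rangle$ is the span of $u$. Nontrivial left ideal means nonzero left ideal. *)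

theory Defs
  imports Complex_Main
begin

text \<open>Vector spaces are the scalar multiplications of the locale \<open>vector_space\<close> on a whole type;
  a field is regarded as a vector space over itself via \<open>(*)\<close>.\<close>

definition bilinear_map ::
  "('k::field \<Rightarrow> 'a::ab_group_add \<Rightarrow> 'a) \<Rightarrow> ('k \<Rightarrow> 'b::ab_group_add \<Rightarrow> 'b) \<Rightarrow> ('a \<Rightarrow> 'a \<Rightarrow> 'b) \<Rightarrow> bool"
  where "bilinear_map s t f \<longleftrightarrow>
    (\<forall>x. Vector_Spaces.linear s t (\<lambda>y. f x y)) \<and> (\<forall>y. Vector_Spaces.linear s t (\<lambda>x. f x y))"

definition lie_bracket ::
  "('k::field \<Rightarrow> 'a::ab_group_add \<Rightarrow> 'a) \<Rightarrow> ('a \<Rightarrow> 'a \<Rightarrow> 'a) \<Rightarrow> bool"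
  where "lie_bracket s br \<longleftrightarrow> bilinear_map s s br \<and> (\<forall>x. br x x = 0) \<and>
    (\<forall>x y z. br x (br y z) + br y (br z x) + br z (br x y) = 0)"

definition commutator :: "('a::ab_group_add \<Rightarrow> 'a \<Rightarrow> 'a) \<Rightarrow> 'a \<Rightarrow> 'a \<Rightarrow> 'a"
  where "commutator star a b = star a b - star b a"

definition lmult :: "('a \<Rightarrow> 'a \<Rightarrow> 'a) \<Rightarrow> 'a \<Rightarrow> 'a \<Rightarrow> 'a"
  where "lmult star a = (\<lambda>b. star a b)"

definition rmult :: "('a \<Rightarrow> 'a \<Rightarrow> 'a) \<Rightarrow> 'a \<Rightarrow> 'a \<Rightarrow> 'a"
  where "rmult star a = (\<lambda>b. star b a)"

locale left_symmetric_algebra = vector_space scale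
  for scale :: "'k::field \<Rightarrow> 'a::ab_group_add \<Rightarrow> 'a" +
  fixes star :: "'a \<Rightarrow> 'a \<Rightarrow> 'a"
  assumes bilinear_star: "bilinear_map scale scale star"
    and lie_bracket_commutator: "lie_bracket scale (commutator star)"
    and lmult_commutator: "lmult star (commutator star a b) x =
      lmult star a (lmult star b x) - lmult star b (lmult star a x)"

definition is_metric ::
  "('k::field \<Rightarrow> 'a::ab_group_add \<Rightarrow> 'a) \<Rightarrow> ('a \<Rightarrow> 'a \<Rightarrow> 'k) \<Rightarrow> bool"
  where "is_metric s h \<longleftrightarrow> bilinear_map s (*) h \<and> (\<forall>x y. h x y = h y x) \<and>
    (\<forall>x. (\<forall>y. h x y = 0) \<longrightarrow> x = 0)"

definition koszul_metric :: "('a \<Rightarrow> 'a \<Rightarrow> 'a) \<Rightarrow> ('a \<Rightarrow> 'k) \<Rightarrow> 'a \<Rightarrow> 'a \<Rightarrow> 'k"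
  where "koszul_metric star lam = (\<lambda>x y. lam (star x y))"

definition koszul_form ::
  "('k::field \<Rightarrow> 'a::ab_group_add \<Rightarrow> 'a) \<Rightarrow> ('a \<Rightarrow> 'a \<Rightarrow> 'a) \<Rightarrow> ('a \<Rightarrow> 'k) \<Rightarrow> bool"
  where "koszul_form s star lam \<longleftrightarrow>
    Vector_Spaces.linear s (*) lam \<and> is_metric s (koszul_metric star lam)"

text \<open>The vector \<open>u\<close> and the adjoint below exist and are unique when \<open>h\<close> is a metric on a
  finite-dimensional space.\<close>

definition associated_idempotent :: "('a \<Rightarrow> 'a \<Rightarrow> 'a) \<Rightarrow> ('a \<Rightarrow> 'k) \<Rightarrow> 'a"
  where "associated_idempotent star lam = (THE u. \<forall>a. lam a = lam (star a u))"

definition adjoint_wrt ::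
  "('k::field \<Rightarrow> 'a::ab_group_add \<Rightarrow> 'a) \<Rightarrow> ('a \<Rightarrow> 'a \<Rightarrow> 'k) \<Rightarrow> ('a \<Rightarrow> 'a) \<Rightarrow> 'a \<Rightarrow> 'a"
  where "adjoint_wrt s h f =
    (THE g. Vector_Spaces.linear s s g \<and> (\<forall>x y. h (f x) y = h x (g y)))"

definition orth_compl :: "('a \<Rightarrow> 'a \<Rightarrow> 'k::zero) \<Rightarrow> 'a set \<Rightarrow> 'a set"
  where "orth_compl h S = {x. \<forall>y\<in>S. h x y = 0}"

definition ker :: "('a \<Rightarrow> 'b::zero) \<Rightarrow> 'a set"
  where "ker f = {x. f x = 0}"

text \<open>Trace of an endomorphism, computed in the basis \<open>B\<close>.\<close>

definition trace_in ::
  "('k::field \<Rightarrow> 'a::ab_group_add \<Rightarrow> 'a) \<Rightarrow> 'a set \<Rightarrow> ('a \<Rightarrow> 'a) \<Rightarrow> 'k"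
  where "trace_in s B f = (\<Sum>b\<in>B. module.representation s B (f b) b)"

definition lie_ideal ::
  "('k::field \<Rightarrow> 'a::ab_group_add \<Rightarrow> 'a) \<Rightarrow> ('a \<Rightarrow> 'a \<Rightarrow> 'a) \<Rightarrow> 'a set \<Rightarrow> bool"
  where "lie_ideal s br S \<longleftrightarrow> module.subspace s S \<and> (\<forall>a. \<forall>x\<in>S. br a x \<in> S)"

definition lie_subalgebra ::
  "('k::field \<Rightarrow> 'a::ab_group_add \<Rightarrow> 'a) \<Rightarrow> ('a \<Rightarrow> 'a \<Rightarrow> 'a) \<Rightarrow> 'a set \<Rightarrow> bool"
  where "lie_subalgebra s br S \<longleftrightarrow> module.subspace s S \<and> (\<forall>x\<in>S. \<forall>y\<in>S. br x y \<in> S)"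

definition left_ideal ::
  "('k::field \<Rightarrow> 'a::ab_group_add \<Rightarrow> 'a) \<Rightarrow> ('a \<Rightarrow> 'a \<Rightarrow> 'a) \<Rightarrow> 'a set \<Rightarrow> bool"
  where "left_ideal s star S \<longleftrightarrow> module.subspace s S \<and> (\<forall>a. \<forall>x\<in>S. star a x \<in> S)"

definition acts_as_derivation_on ::
  "('k::field \<Rightarrow> 'a::ab_group_add \<Rightarrow> 'a) \<Rightarrow> ('a \<Rightarrow> 'a \<Rightarrow> 'a) \<Rightarrow> 'a set \<Rightarrow> ('a \<Rightarrow> 'a) \<Rightarrow> bool"
  where "acts_as_derivation_on s br S D \<longleftrightarrow>
    (\<forall>x\<in>S. D x \<in> S) \<and>
    (\<forall>x\<in>S. \<forall>y\<in>S. D (x + y) = D x + D y) \<and> (\<forall>c. \<forall>x\<in>S. D (s c x) = s c (D x)) \<and>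
    (\<forall>x\<in>S. \<forall>y\<in>S. D (br x y) = br (D x) y + br x (D y))"

end

theory Submission
  imports Defs "HOL-Computational_Algebra.Polynomial"
begin

text \<open>
  Write \<open>h(x, y) = \<lambda>(x \<star> y)\<close>, \<open>L = L(u)\<close>, \<open>R = R(u)\<close>. Everything except the statements about
  nilpotency, trace and dimension is a short computation: applying \<open>\<lambda>\<close> to left symmetry gives
  the Hessian identity, which for \<open>z = u\<close> says that \<open>R\<close> is self-adjoint (because \<open>\<lambda>\<close> vanishes on
  commutators) and for \<open>y = u\<close> says that \<open>L + L\<^sup>* = R + I\<close>. Self-adjointness gives \<open>u \<star> u = u\<close> and
  then \<open>\<lambda> \<circ> R = \<lambda> = \<lambda> \<circ> L\<close>, which accounts for the invariance of \<open>ker \<lambda>\<close> and for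
  \<open>ker R\<^sup>j \<subseteq> ker \<lambda>\<close>. A left ideal inside \<open>ker \<lambda>\<close> is \<open>h\<close>-orthogonal to the whole algebra, hence
  zero. Finally left symmetry with one argument equal to \<open>u\<close> makes \<open>L\<close> a derivation at elements
  of \<open>ker R\<close>.

  The remaining statement depends only on the relation \<open>[L, R] = R - R\<^sup>2\<close>, which is left symmetry
  applied to \<open>u, x, u\<close>. Put \<open>N = R - R\<^sup>2\<close>. Since \<open>[L, \<cdot>]\<close> is a derivation and \<open>N\<close> commutes with
  \<open>R\<close>, one has \<open>[L, p(R)] = p'(R) N\<close> for each polynomial \<open>p\<close>. So if \<open>p(R) = 0\<close>, then
  \<open>p'(R) N = 0\<close>, and by repetition \<open>p\<^sup>(\<^sup>j\<^sup>)(R) N\<^sup>j = 0\<close> for each \<open>j\<close>. For \<open>j = deg p\<close> the derivative is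
  a nonzero constant in characteristic zero, and \<open>N\<close> is nilpotent (\<open>nilpotent_N\<close>).

  The nilpotency of \<open>N = R(1 - R)\<close> splits the space into the parts on which \<open>1 - R\<close> and \<open>R\<close> are
  nilpotent. The projector onto the first part along the second is a polynomial \<open>E = f(R)\<close>, and its
  range is the intersection of the ranges of all \<open>R\<^sup>j\<close> (\<open>range_E_eq_Inter\<close>). As \<open>f\<close> takes the values 0 and 1
  at 0 and 1, \<open>X - f\<close> is a multiple of \<open>X - X\<^sup>2\<close>; hence \<open>R - E = N g(R)\<close>
  is the commutator \<open>[L g(R), R]\<close> and has trace zero. So \<open>tr R = tr E\<close>, and the trace of an
  idempotent is the dimension of its range (\<open>trace_R_eq_dim\<close>). This number is positive because
  \<open>R u = u \<noteq> 0\<close>. A nilpotent endomorphism of a \<open>d\<close>-dimensional space vanishes in its \<open>d\<close>-th power;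
  applied to the two parts this bounds the exponent of \<open>N\<close> (\<open>N_funpow_max_eq_0\<close>).
\<close>

section \<open>Polynomials in an endomorphism\<close>

locale endomorphism = vector_space scale
  for scale :: "'k::field \<Rightarrow> 'a::ab_group_add \<Rightarrow> 'a" (infixr \<open>*s\<close> 75) +
  fixes R :: "'a \<Rightarrow> 'a"
  assumes linear_R: "Vector_Spaces.linear scale scale R"
begin

sublocale R: Vector_Spaces.linear scale scale R
  by (rule linear_R)

text \<open>Horner's scheme, as in the definition of \<open>poly\<close>: this is the endomorphism \<open>p(R)\<close>.\<close>

definition poly_endo :: "'k poly \<Rightarrow> 'a \<Rightarrow> 'a"
  where "poly_endo p = fold_coeffs (\<lambda>a g v. a *s v + R (g v)) p (\<lambda>v. 0)"

lemma poly_endo_0 [simp]: "poly_endo 0 = (\<lambda>v. 0)"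
  by (simp add: poly_endo_def)

lemma poly_endo_pCons [simp]: "poly_endo (pCons a p) v = a *s v + R (poly_endo p v)"
  by (cases "p = 0 \<and> a = 0") (auto simp: poly_endo_def)

lemma poly_endo_1 [simp]: "poly_endo 1 v = v"
  by (simp add: one_pCons)

lemma linear_poly_endo: "Vector_Spaces.linear scale scale (poly_endo p)"
proof (induction p)
  case 0
  show ?case
    by (simp add: Vector_Spaces.linear_iff vector_space_axioms)
next
  case (pCons a p)
  then show ?case
    by (simp add: Vector_Spaces.linear_iff R.add R.scale algebra_simps)
qed

sublocale poly_endo: Vector_Spaces.linear scale scale "poly_endo p" for p
  by (rule linear_poly_endo)

lemma poly_endo_add: "poly_endo (p + q) v = poly_endo p v + poly_endo q v"
  by (induction p q rule: poly_induct2) (simp_all add: R.add algebra_simps)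

lemma poly_endo_smult: "poly_endo (smult c p) v = c *s poly_endo p v"
  by (induction p) (simp_all add: R.scale algebra_simps)

lemma poly_endo_diff: "poly_endo (p - q) v = poly_endo p v - poly_endo q v"
  using poly_endo_add[of "p - q" q v] by simp

lemma poly_endo_sum: "poly_endo (sum f I) v = (\<Sum>i\<in>I. poly_endo (f i) v)"
  by (induction I rule: infinite_finite_induct) (simp_all add: poly_endo_add)

lemma poly_endo_mult: "poly_endo (p * q) v = poly_endo p (poly_endo q v)"
  by (induction p) (simp_all add: poly_endo_add poly_endo_smult)

lemma poly_endo_commute: "poly_endo p (poly_endo q v) = poly_endo q (poly_endo p v)"
  by (metis mult.commute poly_endo_mult)

lemma poly_endo_power: "poly_endo (p ^ i) = poly_endo p ^^ i"
  by (induction i) (simp_all add: fun_eq_iff poly_endo_mult)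

lemma poly_endo_X: "poly_endo [:0, 1:] = R"
  by (simp add: fun_eq_iff)

lemma poly_endo_monom: "poly_endo (monom c i) v = c *s (R ^^ i) v"
  using poly_endo_power[of "[:0, 1:]" i] by (simp only: monom_altdef poly_endo_smult poly_endo_X)

lemma poly_endo_fixed_vector: "R v = v \<Longrightarrow> poly_endo p v = poly p 1 *s v"
  by (induction p) (simp_all add: R.scale algebra_simps)

lemma poly_endo_dvd_eq_0: "(\<And>v. poly_endo p v = 0) \<Longrightarrow> p dvd q \<Longrightarrow> poly_endo q v = 0"
  by (metis dvdE poly_endo_mult poly_endo_commute)

end

lemma (in vector_space) linear_funpow:
  assumes "Vector_Spaces.linear scale scale f"
  shows "Vector_Spaces.linear scale scale (f ^^ i)"
  using assms by (induction i) (simp_all add: Vector_Spaces.linear_iff)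

locale finite_dimensional_endomorphism =
  finite_dimensional_vector_space scale Basis + endomorphism scale R
  for scale :: "'k::field \<Rightarrow> 'a::ab_group_add \<Rightarrow> 'a" (infixr \<open>*s\<close> 75) and Basis R
begin

text \<open>The vectors \<open>v, R v, \<dots>, R\<^sup>d v\<close>, where \<open>d\<close> is the dimension, are linearly dependent, and a
  dependency between them is the required polynomial. A repetition among the powers has to be treated apart, since it makes
  the set of these vectors too small.\<close>

lemma annihilating_poly_vector: "\<exists>p. p \<noteq> 0 \<and> poly_endo p v = 0"
proof (cases "inj (\<lambda>i. (R ^^ i) v)")
  case False
  then obtain i j where ij: "(R ^^ i) v = (R ^^ j) v" "i \<noteq> j"
    by (auto simp: inj_def)
  have "coeff (monom 1 i - monom (1 :: 'k) j) i = 1"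
    using ij(2) by simp
  then have "monom 1 i - monom (1 :: 'k) j \<noteq> 0"
    by force
  moreover have "poly_endo (monom 1 i - monom 1 j) v = 0"
    by (simp add: poly_endo_diff poly_endo_monom ij(1))
  ultimately show ?thesis by blast
next
  case True
  let ?S = "(\<lambda>i. (R ^^ i) v) ` {..dimension}"
  have inj: "inj_on (\<lambda>i. (R ^^ i) v) {..dimension}"
    using True inj_on_subset by blast
  then have "card ?S = Suc dimension"
    by (simp add: card_image)
  then have "dependent ?S"
    using dim_subset_UNIV[of ?S] by (intro dependent_biggerset_general) simp
  then obtain c where c: "\<exists>w\<in>?S. c w \<noteq> 0" "(\<Sum>w\<in>?S. c w *s w) = 0"
    using dependent_finite[of ?S] by blast
  define p where "p = (\<Sum>i\<le>dimension. monom (c ((R ^^ i) v)) i)"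
  have "poly_endo p v = (\<Sum>i\<le>dimension. c ((R ^^ i) v) *s (R ^^ i) v)"
    by (simp add: p_def poly_endo_sum poly_endo_monom)
  also have "\<dots> = 0"
    using c(2) by (simp add: sum.reindex[OF inj])
  finally have "poly_endo p v = 0" .
  moreover obtain i where i: "i \<le> dimension" "c ((R ^^ i) v) \<noteq> 0"
    using c(1) by auto
  have "coeff p i = c ((R ^^ i) v)"
    using i(1) by (simp add: p_def coeff_sum if_distrib sum.delta' cong: if_cong)
  with i(2) have "p \<noteq> 0" by force
  ultimately show ?thesis by blast
qed

text \<open>The product of polynomials that annihilate the basis vectors one at a time annihilates
  everything.\<close>

lemma annihilating_poly: "\<exists>p. p \<noteq> 0 \<and> (\<forall>v. poly_endo p v = 0)"
proof -
  obtain f where f: "\<And>b. f b \<noteq> 0" "\<And>b. poly_endo (f b) b = 0"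
    using annihilating_poly_vector by metis
  define p where "p = prod f Basis"
  have "poly_endo p b = 0" if "b \<in> Basis" for b
  proof -
    have "p = prod f (Basis - {b}) * f b"
      using that finite_Basis by (simp add: p_def prod.remove mult.commute)
    then show ?thesis
      by (simp add: poly_endo_mult f(2))
  qed
  then have "poly_endo p v = 0" for v
    using poly_endo.eq_0_on_span[of Basis p v] span_Basis by auto
  moreover have "p \<noteq> 0"
    using f(1) finite_Basis by (simp add: p_def)
  ultimately show ?thesis by blast
qed

end

section \<open>Trace, nilpotency and dimension\<close>

context finite_dimensional_vector_space
begin

text \<open>The identity \<open>tr(f g) = tr(g f)\<close>, with the two traces computed in different bases: both sides
  are the same double sum once \<open>g b\<close> is expanded in \<open>C\<close> and \<open>f c\<close> in \<open>B\<close>. Taking \<open>g = id\<close> gives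
  independence of the basis.\<close>

lemma trace_in_comp_commute:
  assumes B: "independent B" "span B = UNIV" and C: "independent C" "span C = UNIV"
    and f: "Vector_Spaces.linear scale scale f" and g: "Vector_Spaces.linear scale scale g"
  shows "trace_in scale B (\<lambda>x. f (g x)) = trace_in scale C (\<lambda>x. g (f x))"
proof -
  have expand: "trace_in scale D (\<lambda>x. p (q x))
      = (\<Sum>b\<in>D. \<Sum>c\<in>D'. representation D' (q b) c * representation D (p c) b)"
    if D: "independent D" "span D = UNIV" and D': "independent D'" "span D' = UNIV"
      and p: "Vector_Spaces.linear scale scale p" for D D' p q
    unfolding trace_in_def
  proof (rule sum.cong[OF refl])
    fix b
    interpret p: Vector_Spaces.linear scale scale p by (rule p)
    interpret r: Vector_Spaces.linear scale "(*)" "\<lambda>v. representation D v b"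
      by (rule linear_representation[OF D])
    have "q b = (\<Sum>c\<in>D'. representation D' (q b) c *s c)"
      using D' finiteI_independent by (simp add: sum_representation_eq)
    then have "representation D (p (q b)) b
        = representation D (p (\<Sum>c\<in>D'. representation D' (q b) c *s c)) b"
      by simp
    also have "\<dots> = (\<Sum>c\<in>D'. representation D' (q b) c * representation D (p c) b)"
      by (simp add: p.sum p.scale r.sum r.scale)
    finally show "representation D (p (q b)) b
        = (\<Sum>c\<in>D'. representation D' (q b) c * representation D (p c) b)" .
  qed
  show ?thesis
    unfolding expand[OF B C f] expand[OF C B g]
    by (subst sum.swap) (simp add: mult.commute)
qed

lemma trace_in_diff:
  assumes "independent B" "span B = UNIV"
  shows "trace_in scale B (\<lambda>x. f x - g x) = trace_in scale B f - trace_in scale B g"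
  using assms by (simp add: trace_in_def representation_diff sum_subtractf)

text \<open>Compute in a basis that extends a basis \<open>C0\<close> of the range. The vectors of \<open>C0\<close> are fixed and
  contribute 1 each. The others are mapped into the span of \<open>C0\<close>, so they have zero diagonal
  entry.\<close>

lemma trace_in_idempotent:
  assumes B: "independent B" "span B = UNIV"
    and E: "Vector_Spaces.linear scale scale E" and idem: "\<And>x. E (E x) = E x"
  shows "trace_in scale B E = of_nat (dim (range E))"
proof -
  interpret E: Vector_Spaces.linear scale scale E by (rule E)
  obtain C0 where C0: "C0 \<subseteq> range E" "independent C0" "range E \<subseteq> span C0"
      "card C0 = dim (range E)"
    using basis_exists by blast
  obtain C where C: "C0 \<subseteq> C" "independent C" "span C = UNIV"
    using extend_basis_superset[OF C0(2)] independent_extend_basis[OF C0(2)]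
      span_extend_basis[OF C0(2)] by metis
  have finC: "finite C"
    using C(2) finiteI_independent by blast
  have diag: "representation C (E c) c = (if c \<in> C0 then 1 else 0)" if c: "c \<in> C" for c
  proof (cases "c \<in> C0")
    case True
    then have "E c = c"
      using C0(1) idem by auto
    with True c C(2) show ?thesis
      by (simp add: representation_basis)
  next
    case False
    have "E c \<in> span C0"
      using C0(3) by auto
    then have "representation C (E c) = representation C0 (E c)"
      by (intro representation_extend C)
    with False show ?thesis
      using representation_ne_zero[of C0 "E c" c] by auto
  qed
  have "trace_in scale B E = trace_in scale C E"
    using trace_in_comp_commute[OF B C(2,3) E linear_ident] by simp
  also have "\<dots> = (\<Sum>c\<in>C. if c \<in> C0 then 1 else 0)"
    unfolding trace_in_def by (rule sum.cong) (simp_all add: diag)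
  also have "\<dots> = of_nat (card C0)"
    using finC C(1) by (simp add: sum.If_cases Int_absorb1)
  finally show ?thesis
    using C0(4) by simp
qed

text \<open>The subspaces \<open>S\<^sup>i W\<close> decrease, and once two successive ones agree they all agree from there on,
  which by nilpotency means that they are zero. So the dimension drops at each step until then.\<close>

lemma nilpotent_on_subspace_funpow_dim:
  assumes S: "Vector_Spaces.linear scale scale S" and W: "subspace W" and inv: "S ` W \<subseteq> W"
    and nil: "\<And>w. w \<in> W \<Longrightarrow> (S ^^ m) w = 0" and w: "w \<in> W" and j: "dim W \<le> j"
  shows "(S ^^ j) w = 0"
proof -
  define V where "V i = (S ^^ i) ` W" for i
  have V_Suc: "V (Suc i) = S ` V i" for i
    by (auto simp: V_def image_image)
  have sub: "subspace (V i)" for i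
    unfolding V_def
    using linear_funpow[OF S] W
    by (meson linear_module_homI module_hom.subspace_image module_hom_linearI)
  have dec: "V (Suc i) \<subseteq> V i" for i
    using inv by (induction i) (force simp: V_def, metis V_Suc image_mono)
  have zero: "0 \<in> V i" for i
    using sub subspace_0 by blast
  have "V i = {0} \<or> dim (V i) + i \<le> dim W" for i
  proof (induction i)
    case 0
    show ?case by (simp add: V_def)
  next
    case (Suc i)
    show ?case
    proof (cases "V (Suc i) = V i")
      case True
      have "V (i + d) = V i" for d
        by (induction d) (use True V_Suc in auto)
      then have "V i = V (i + m)" by simp
      also have "\<dots> \<subseteq> {0}"
      proof -
        have "(S ^^ i) ` W \<subseteq> W"
          using inv by (induction i) auto
        then show ?thesis
          using nil by (auto simp: V_def add.commute[of i m] funpow_add)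
      qed
      finally show ?thesis
        using zero True by blast
    next
      case False
      then have "dim (V (Suc i)) < dim (V i)"
        using subspace_dim_equal[OF sub sub dec] by (meson not_le)
      with Suc.IH show ?thesis
        using dec[of i] zero[of "Suc i"] by auto
    qed
  qed
  from this[of j] j have "V j = {0} \<or> dim (V j) = 0"
    by linarith
  then have "V j \<subseteq> {0}"
    by (simp only: dim_eq_0) blast
  with w show ?thesis
    by (auto simp: V_def)
qed

lemma dim_range_plus_dim_ker_idempotent:
  assumes E: "Vector_Spaces.linear scale scale E" and idem: "\<And>x. E (E x) = E x"
  shows "dim (range E) + dim {x. E x = 0} = dim UNIV"
proof -
  interpret E: Vector_Spaces.linear scale scale E by (rule E)
  have "x \<in> {a + b |a b. a \<in> range E \<and> b \<in> {x. E x = 0}}" for x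
  proof -
    have "x = E x + (x - E x)" "E (x - E x) = 0"
      by (simp_all add: E.diff idem)
    then show ?thesis by blast
  qed
  then have "{a + b |a b. a \<in> range E \<and> b \<in> {x. E x = 0}} = UNIV"
    by blast
  moreover have "range E \<inter> {x. E x = 0} = {0}"
    using idem E.zero by (auto simp: image_iff) (metis E.zero)
  ultimately show ?thesis
    using dim_sums_Int[OF E.subspace_image[OF subspace_UNIV] E.subspace_kernel] by simp
qed

end

section \<open>Endomorphisms with \<open>[L, R] = R - R\<^sup>2\<close>\<close>

locale bracket_pair = finite_dimensional_endomorphism scale Basis R
  for scale :: "'k::field_char_0 \<Rightarrow> 'a::ab_group_add \<Rightarrow> 'a" (infixr \<open>*s\<close> 75) and Basis R +
  fixes L :: "'a \<Rightarrow> 'a"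
  assumes linear_L: "Vector_Spaces.linear scale scale L"
    and bracket: "L (R x) - R (L x) = R x - R (R x)"
begin

sublocale L: Vector_Spaces.linear scale scale L
  by (rule linear_L)

abbreviation N :: "'a \<Rightarrow> 'a" where "N \<equiv> \<lambda>x. R x - R (R x)"

abbreviation X :: "'k poly" where "X \<equiv> [:0, 1:]"

lemma poly_endo_N: "poly_endo (X - X\<^sup>2) = N"
  by (simp only: fun_eq_iff poly_endo_diff poly_endo_power poly_endo_X)
    (simp add: numeral_2_eq_2)

text \<open>
  The map \<open>T \<mapsto> [L, T]\<close> is a derivation and takes \<open>R\<close> to \<open>N\<close>, which commutes with \<open>R\<close>. So it acts on
  polynomials in \<open>R\<close> as \<open>(X - X\<^sup>2) d/dX\<close>.
\<close>

lemma bracket_poly_endo: "L (poly_endo p v) - poly_endo p (L v) = poly_endo (pderiv p * (X - X\<^sup>2)) v"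
proof (induction p arbitrary: v)
  case 0
  show ?case by (simp add: L.zero)
next
  case (pCons a p)
  let ?w = "poly_endo p v"
  have "L (poly_endo (pCons a p) v) - poly_endo (pCons a p) (L v) = L (R ?w) - R (poly_endo p (L v))"
    by (simp add: poly_endo_mult poly_endo_diff poly_endo_smult L.add L.scale)
  also have "\<dots> = N ?w + R (L ?w - poly_endo p (L v))"
    using bracket[of ?w] by (simp add: R.diff algebra_simps)
  also have "\<dots> = poly_endo (X - X\<^sup>2) ?w + poly_endo X (poly_endo (pderiv p * (X - X\<^sup>2)) v)"
    by (simp only: pCons.IH poly_endo_N poly_endo_X)
  also have "\<dots> = poly_endo ((X - X\<^sup>2) * p + X * (pderiv p * (X - X\<^sup>2))) v"
    by (simp only: poly_endo_add poly_endo_mult)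
  also have "(X - X\<^sup>2) * p + X * (pderiv p * (X - X\<^sup>2)) = pderiv (pCons a p) * (X - X\<^sup>2)"
    by (simp add: pderiv_pCons algebra_simps)
  finally show ?case .
qed

lemma annihilator_closed:
  assumes "\<And>v. poly_endo p v = 0"
  shows "poly_endo (pderiv p * (X - X\<^sup>2)) v = 0"
  using bracket_poly_endo[of p v] assms by (simp add: L.zero)

text \<open>With \<open>t = X - X\<^sup>2\<close>, the ideal of polynomials that annihilate \<open>R\<close> is closed under \<open>q \<mapsto> q' t\<close>.
  Applied to \<open>q = p\<^sup>(\<^sup>j\<^sup>) t\<^sup>j\<close> this gives \<open>p\<^sup>(\<^sup>j\<^sup>+\<^sup>1\<^sup>) t\<^sup>j\<^sup>+\<^sup>1\<close> plus a multiple of \<open>q\<close>, and the latter lies in the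
  ideal already.\<close>

lemma annihilator_iterated:
  assumes "\<And>v. poly_endo p v = 0"
  shows "poly_endo ((pderiv ^^ j) p * (X - X\<^sup>2) ^ j) v = 0"
proof (induction j arbitrary: v)
  case 0
  show ?case using assms by simp
next
  case (Suc j)
  let ?t = "X - X\<^sup>2" and ?q = "(pderiv ^^ j) p"
  have smult_of_nat: "smult (of_nat i) r = of_nat i * r" for i and r :: "'k poly"
    by (simp add: of_nat_poly)
  have "pderiv (q * t ^ j) * t = pderiv q * t ^ Suc j + (of_nat j * pderiv t) * (q * t ^ j)"
    for q t :: "'k poly"
  proof (cases j)
    case (Suc i)
    show ?thesis
      unfolding Suc pderiv_mult pderiv_power_Suc smult_of_nat
      by (simp add: algebra_simps del: of_nat_Suc)
  qed (simp add: pderiv_mult)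
  then have "pderiv (?q * ?t ^ j) * ?t
      = pderiv ?q * ?t ^ Suc j + (of_nat j * pderiv ?t) * (?q * ?t ^ j)" .
  then have "pderiv ?q * ?t ^ Suc j
      = pderiv (?q * ?t ^ j) * ?t - (of_nat j * pderiv ?t) * (?q * ?t ^ j)"
    by simp
  then have "poly_endo (pderiv ?q * ?t ^ Suc j) v
      = poly_endo (pderiv (?q * ?t ^ j) * ?t) v - poly_endo ((of_nat j * pderiv ?t) * (?q * ?t ^ j)) v"
    by (simp only: poly_endo_diff)
  also have "\<dots> = 0"
    using annihilator_closed[OF Suc.IH] poly_endo_dvd_eq_0[OF Suc.IH, OF dvd_triv_right] by simp
  finally show ?case by simp
qed

text \<open>Differentiate an annihilating polynomial as often as its degree: what remains is a constant,
  nonzero since the characteristic is zero, times a power of \<open>N\<close>.\<close>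

lemma nilpotent_N: "\<exists>m. N ^^ m = (\<lambda>x. 0)"
proof -
  obtain p where p: "p \<noteq> 0" "\<And>v. poly_endo p v = 0"
    using annihilating_poly by blast
  define c where "c = coeff ((pderiv ^^ degree p) p) 0"
  have deg: "degree ((pderiv ^^ j) p) = degree p - j" for j
    by (induction j) (simp_all add: degree_pderiv)
  have ne: "j \<le> degree p \<Longrightarrow> (pderiv ^^ j) p \<noteq> 0" for j
  proof (induction j)
    case (Suc j)
    then show ?case using deg[of j] by (simp add: pderiv_eq_0_iff)
  qed (simp add: p(1))
  have const: "(pderiv ^^ degree p) p = [:c:]"
    using deg[of "degree p"] by (metis c_def degree_0_id diff_self_eq_0 of_nat_0)
  with ne[of "degree p"] have "c \<noteq> 0" by auto
  have "(N ^^ degree p) v = 0" for v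
  proof -
    have "c *s (N ^^ degree p) v = 0"
      using annihilator_iterated[OF p(2), of "degree p" v] unfolding const
      by (simp add: poly_endo_mult poly_endo_diff poly_endo_smult poly_endo_power poly_endo_N)
    with \<open>c \<noteq> 0\<close> show ?thesis by simp
  qed
  then show ?thesis by auto
qed

text \<open>Any positive exponent that annihilates \<open>N\<close> will do. It must be positive so that \<open>X\<close> divides
  \<open>X ^ nil_exp\<close>.\<close>

definition nil_exp :: nat
  where "nil_exp = (SOME i. 1 \<le> i \<and> N ^^ i = (\<lambda>x. 0))"

lemma nil_exp: "1 \<le> nil_exp" "N ^^ nil_exp = (\<lambda>x. 0)"
proof -
  obtain j where "N ^^ j = (\<lambda>x. 0)"
    using nilpotent_N by blast
  then have "1 \<le> Suc j \<and> N ^^ Suc j = (\<lambda>x. 0)"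
    by (simp add: fun_eq_iff R.zero)
  then have "1 \<le> nil_exp \<and> N ^^ nil_exp = (\<lambda>x. 0)"
    unfolding nil_exp_def by (rule someI)
  then show "1 \<le> nil_exp" "N ^^ nil_exp = (\<lambda>x. 0)" by auto
qed

lemma annihilated_if_dvd: "(X * (1 - X)) ^ nil_exp dvd p \<Longrightarrow> poly_endo p v = 0"
proof (rule poly_endo_dvd_eq_0)
  have "X * (1 - X) = X - X\<^sup>2"
    by (simp add: power2_eq_square algebra_simps)
  then show "poly_endo ((X * (1 - X)) ^ nil_exp) v = 0" for v
    by (simp only: poly_endo_power poly_endo_N nil_exp)
qed

text \<open>A polynomial congruent to 0 modulo \<open>X\<^sup>m\<close> and to 1 modulo \<open>(1 - X)\<^sup>m\<close>, where \<open>m\<close> is \<open>nil_exp\<close>.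
  Its value \<open>E\<close> at \<open>R\<close> is therefore the projector onto the generalized eigenspace of \<open>R\<close> for the
  eigenvalue 1, along the one for 0.\<close>

definition projector_poly :: "'k poly"
  where "projector_poly = 1 - (1 - X ^ nil_exp) ^ nil_exp"

abbreviation E :: "'a \<Rightarrow> 'a" where "E \<equiv> poly_endo projector_poly"

lemma X_power_dvd_projector_poly: "X ^ nil_exp dvd projector_poly"
proof -
  obtain q where "(1 - X ^ nil_exp) ^ nil_exp - 1 = ((1 - X ^ nil_exp) - 1) * q"
    by (metis power_diff_1_eq)
  then have "projector_poly = X ^ nil_exp * q"
    by (simp add: projector_poly_def algebra_simps)
  then show ?thesis by simp
qed

lemma one_minus_X_power_dvd: "(1 - X) ^ nil_exp dvd 1 - projector_poly"
proof -
  obtain q where "X ^ nil_exp - 1 = (X - 1) * q"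
    by (metis power_diff_1_eq)
  then have "1 - X ^ nil_exp = (1 - X) * q"
    by (simp add: algebra_simps)
  then have "(1 - X) ^ nil_exp dvd (1 - X ^ nil_exp) ^ nil_exp"
    by (intro dvd_power_same) simp
  then show ?thesis
    by (simp add: projector_poly_def)
qed

lemma E_idem: "E (E x) = E x"
proof -
  have "(X * (1 - X)) ^ nil_exp dvd projector_poly * (1 - projector_poly)"
    unfolding power_mult_distrib
    by (intro mult_dvd_mono X_power_dvd_projector_poly one_minus_X_power_dvd)
  then have "poly_endo (projector_poly * (1 - projector_poly)) x = 0"
    by (rule annihilated_if_dvd)
  then show ?thesis
    by (simp add: poly_endo_mult poly_endo_diff poly_endo.diff)
qed

lemma E_kills: "poly_endo ((1 - X) ^ nil_exp) (E x) = 0" "poly_endo (X ^ nil_exp) (x - E x) = 0"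
proof -
  have "poly_endo ((1 - X) ^ nil_exp * projector_poly) x = 0"
    by (rule annihilated_if_dvd)
      (simp only: power_mult_distrib mult.commute[of "(1 - X) ^ nil_exp"] mult_dvd_mono dvd_refl
        X_power_dvd_projector_poly)
  then show "poly_endo ((1 - X) ^ nil_exp) (E x) = 0"
    by (simp only: poly_endo_mult)
  have "poly_endo (X ^ nil_exp * (1 - projector_poly)) x = 0"
    by (rule annihilated_if_dvd)
      (simp only: power_mult_distrib mult_dvd_mono dvd_refl one_minus_X_power_dvd)
  then show "poly_endo (X ^ nil_exp) (x - E x) = 0"
    by (simp only: poly_endo_mult poly_endo_diff poly_endo_1)
qed

text \<open>The polynomial of \<open>E\<close> is a multiple of \<open>X\<close>, so \<open>R\<close> is onto on the range of \<open>E\<close>; conversely the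
  power \<open>R ^^ nil_exp\<close> kills the complementary part and so maps into the range of \<open>E\<close>.\<close>

lemma range_E_eq_Inter: "range E = (\<Inter>j\<in>{1..}. range (R ^^ j))"
proof (intro equalityI subsetI INT_I)
  fix y j
  assume "y \<in> range E"
  obtain q where q: "projector_poly = X * q"
    using X_power_dvd_projector_poly nil_exp(1) by (metis dvdE dvd_power dvd_trans less_le_trans zero_less_one)
  have "z \<in> range E \<Longrightarrow> z \<in> range (R ^^ j)" for z
  proof (induction j arbitrary: z)
    case (Suc j)
    have "z = E (E z)"
      using Suc.prems E_idem by auto
    also have "\<dots> = poly_endo X (E (poly_endo q z))"
      by (metis q poly_endo_mult poly_endo_commute)
    also have "\<dots> = R (E (poly_endo q z))"
      by (simp only: poly_endo_X)
    finally have "z = R (E (poly_endo q z))" .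
    moreover obtain w where "E (poly_endo q z) = (R ^^ j) w"
      using Suc.IH by blast
    ultimately have "z = (R ^^ Suc j) w" by simp
    then show ?case by blast
  qed simp
  then show "y \<in> range (R ^^ j)"
    using \<open>y \<in> range E\<close> by blast
next
  fix x
  assume "x \<in> (\<Inter>j\<in>{1..}. range (R ^^ j))"
  then obtain y where "x = (R ^^ nil_exp) y"
    using nil_exp(1) by auto
  then have "x = poly_endo (X ^ nil_exp) y"
    by (simp only: poly_endo_power poly_endo_X)
  then have "x - E x = poly_endo (X ^ nil_exp) (y - E y)"
    by (simp only: poly_endo.diff poly_endo_commute[of projector_poly])
  also have "\<dots> = 0"
    by (rule E_kills)
  finally show "x \<in> range E"
    by (metis eq_iff_diff_eq_0 rangeI)
qed

text \<open>Modulo \<open>X - X\<^sup>2\<close> a polynomial is determined by its values at 0 and 1, and there \<open>X\<close> agrees with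
  \<open>projector_poly\<close>. Hence \<open>R - E\<close> is \<open>N\<close> times some \<open>G\<close> that commutes with \<open>R\<close>, that is,
  \<open>[L, R] G = [L G, R]\<close>, which has trace zero.\<close>

lemma trace_R_eq_dim: "trace_in scale Basis R = of_nat (dim (range E))"
proof -
  have "X dvd X - projector_poly"
    using nil_exp(1) by (simp add: dvd_iff_poly_eq_0 projector_poly_def power_0_left)
  then obtain q where q: "X - projector_poly = X * q" ..
  have "poly (X * q) 1 = 0"
    unfolding q[symmetric] using nil_exp(1) by (simp add: projector_poly_def)
  \<comment> \<open>The root 1 of \<open>X - projector_poly\<close> is not a root of \<open>X\<close>, so it is a root of \<open>q\<close>.\<close>
  then have "[:-1, 1:] dvd q"
    by (simp add: poly_eq_0_iff_dvd)
  then obtain r where r: "q = [:-1, 1:] * r" ..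
  have "X - projector_poly = (X - X\<^sup>2) * (- r)"
    by (simp add: q r power2_eq_square algebra_simps)
  then have RE: "R x - E x = N (poly_endo (- r) x)" for x
    by (metis poly_endo_diff poly_endo_mult poly_endo_N poly_endo_X)
  define G where "G = poly_endo (- r)"
  have "R (G x) = G (R x)" for x
    using poly_endo_commute[of X "- r" x] unfolding G_def poly_endo_X .
  with RE have RE: "R x - E x = L (G (R x)) - R (L (G x))" for x
    using bracket[of "G x"] by (simp add: G_def)
  have LG: "Vector_Spaces.linear scale scale (\<lambda>x. L (G x))"
    by (simp add: G_def Vector_Spaces.linear_iff vector_space_axioms L.add L.scale
        poly_endo.add poly_endo.scale)
  have B: "independent Basis" "span Basis = UNIV"
    by (simp_all add: independent_Basis span_Basis)
  have "trace_in scale Basis R - trace_in scale Basis E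
      = trace_in scale Basis (\<lambda>x. L (G (R x))) - trace_in scale Basis (\<lambda>x. R (L (G x)))"
    by (simp only: trace_in_diff[OF B, symmetric] RE)
  also have "\<dots> = 0"
    using trace_in_comp_commute[OF B B LG linear_R] by simp
  finally show ?thesis
    using trace_in_idempotent[OF B linear_poly_endo E_idem] by simp
qed

text \<open>\<open>N = R (1 - R)\<close> inherits nilpotency from \<open>1 - R\<close> on the range of \<open>E\<close> and from \<open>R\<close> on its kernel;
  the exponents are bounded by the dimensions of these two subspaces.\<close>

lemma N_funpow_max_eq_0: "N ^^ max (dim (range E)) (dim UNIV - dim (range E)) = (\<lambda>x. 0)"
proof
  fix x
  define j where "j = max (dim (range E)) (dim UNIV - dim (range E))"
  have "((poly_endo (1 - X)) ^^ j) (E x) = 0"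
  proof (rule nilpotent_on_subspace_funpow_dim[where W = "range E" and m = nil_exp])
    show "poly_endo (1 - X) ` range E \<subseteq> range E"
      by (auto simp only: poly_endo_commute[of "1 - X"])
    show "(poly_endo (1 - X) ^^ nil_exp) w = 0" if "w \<in> range E" for w
      using that E_kills(1) by (auto simp only: poly_endo_power[symmetric])
  qed (simp_all add: linear_poly_endo poly_endo.subspace_image j_def)
  then have 1: "poly_endo ((1 - X) ^ j) (E x) = 0"
    by (simp only: poly_endo_power)
  have "(poly_endo X ^^ j) (x - E x) = 0"
  proof (rule nilpotent_on_subspace_funpow_dim[where W = "{x. E x = 0}" and m = nil_exp])
    show "poly_endo X ` {x. E x = 0} \<subseteq> {x. E x = 0}"
      by (auto simp only: poly_endo_commute[of projector_poly] poly_endo.zero)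
    show "(poly_endo X ^^ nil_exp) w = 0" if "w \<in> {x. E x = 0}" for w
      using that E_kills(2)[of w] by (simp only: poly_endo_power[symmetric]) simp
    show "dim {x. E x = 0} \<le> j"
      using dim_range_plus_dim_ker_idempotent[OF linear_poly_endo E_idem] by (simp add: j_def)
  qed (simp_all add: linear_poly_endo poly_endo.subspace_kernel poly_endo.diff E_idem)
  then have 2: "poly_endo (X ^ j) (x - E x) = 0"
    by (simp only: poly_endo_power)
  have factor: "X - X\<^sup>2 = X * (1 - X)"
    by (simp add: power2_eq_square algebra_simps)
  have "N ^^ j = poly_endo ((X - X\<^sup>2) ^ j)"
    by (simp only: poly_endo_power poly_endo_N)
  then have N: "N ^^ j = poly_endo (X ^ j * (1 - X) ^ j)"
    unfolding factor power_mult_distrib .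
  have "(N ^^ j) x = (N ^^ j) (E x) + (N ^^ j) (x - E x)"
    unfolding N poly_endo.add[symmetric] by simp
  also have "(N ^^ j) (E x) = poly_endo (X ^ j) (poly_endo ((1 - X) ^ j) (E x))"
    unfolding N poly_endo_mult ..
  also have "(N ^^ j) (x - E x) = poly_endo ((1 - X) ^ j) (poly_endo (X ^ j) (x - E x))"
    unfolding N poly_endo_mult by (rule poly_endo_commute)
  finally have "(N ^^ j) x = 0"
    unfolding 1 2 poly_endo.zero add_0_left .
  then show "(N ^^ max (dim (range E)) (dim UNIV - dim (range E))) x = 0"
    unfolding j_def .
qed

lemma fixed_vector_in_range_E:
  assumes "R v = v"
  shows "v \<in> range E"
proof -
  have "poly projector_poly 1 = 1"
    using nil_exp(1) by (simp add: projector_poly_def power_0_left)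
  then have "E v = v"
    using poly_endo_fixed_vector[OF assms, of projector_poly] by simp
  then show ?thesis by (metis rangeI)
qed

end

section \<open>Koszul forms\<close>

locale koszul_algebra =
  finite_dimensional_vector_space scale Basis + left_symmetric_algebra scale star
  for scale :: "'k::field \<Rightarrow> 'a::ab_group_add \<Rightarrow> 'a" (infixr \<open>*s\<close> 75)
    and Basis and star (infixl \<open>\<star>\<close> 70) +
  fixes lam :: "'a \<Rightarrow> 'k"
  assumes koszul: "koszul_form scale star lam"
begin

abbreviation h :: "'a \<Rightarrow> 'a \<Rightarrow> 'k" where "h \<equiv> koszul_metric star lam"

lemma h_def: "h x y = lam (x \<star> y)"
  by (simp add: koszul_metric_def)

lemma linear_star_left: "Vector_Spaces.linear scale scale (\<lambda>x. x \<star> y)"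
  and linear_star_right: "Vector_Spaces.linear scale scale (\<lambda>y. x \<star> y)"
  using bilinear_star by (simp_all add: bilinear_map_def)

sublocale star_left: Vector_Spaces.linear scale scale "\<lambda>x. x \<star> y" for y
  by (rule linear_star_left)
sublocale star_right: Vector_Spaces.linear scale scale "\<lambda>y. x \<star> y" for x
  by (rule linear_star_right)
sublocale lam: Vector_Spaces.linear scale "(*)" lam
  using koszul by (simp add: koszul_form_def)
sublocale lam_star: Vector_Spaces.linear scale "(*)" "\<lambda>x. lam (x \<star> y)" for y
  by (simp add: Vector_Spaces.linear_iff vector_space_axioms lam.vs2.vector_space_axioms
      star_left.add star_left.scale lam.add lam.scale)

lemma h_sym: "h x y = h y x"
  and h_nondegenerate: "(\<And>y. h x y = 0) \<Longrightarrow> x = 0"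
  using koszul by (auto simp: koszul_form_def is_metric_def)

lemma left_symmetric: "(x \<star> y - y \<star> x) \<star> z = x \<star> (y \<star> z) - y \<star> (x \<star> z)"
  using lmult_commutator[of x y z] by (simp add: lmult_def commutator_def)

lemma h_eqI: "(\<And>x. h x y = h x z) \<Longrightarrow> y = z"
  using h_nondegenerate[of "y - z"]
  by (simp add: h_sym[of "y - z"]) (simp add: h_def star_right.diff lam.diff)

lemma lam_commutator: "lam (x \<star> y - y \<star> x) = 0"
  using h_sym[of x y] by (simp add: h_def lam.diff)

lemma hessian: "h (x \<star> y - y \<star> x) z = h x (y \<star> z) - h y (x \<star> z)"
  by (simp add: h_def left_symmetric lam.diff)

lemma adjoint_wrt_eqI:
  assumes g: "Vector_Spaces.linear scale scale g" and adj: "\<And>x y. h (f x) y = h x (g y)"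
  shows "adjoint_wrt scale h f = g"
  unfolding adjoint_wrt_def
proof (rule the_equality)
  fix g' assume "Vector_Spaces.linear scale scale g' \<and> (\<forall>x y. h (f x) y = h x (g' y))"
  then have "h x (g' y) = h x (g y)" for x y
    using adj by metis
  then show "g' = g"
    by (intro ext h_eqI)
qed (use assms in auto)

text \<open>Collecting the values \<open>h(b, y)\<close> for basis vectors \<open>b\<close> as coordinates turns \<open>y \<mapsto> h(\<cdot>, y)\<close> into an
  endomorphism \<open>T\<close>. It is injective as \<open>h\<close> is nondegenerate, hence surjective, and the preimage
  of the vector with coordinates \<open>\<lambda>(b)\<close> represents \<open>\<lambda>\<close>.\<close>

lemma lam_represented: "\<exists>u. \<forall>a. lam a = lam (a \<star> u)"
proof -
  define T where "T y = (\<Sum>b\<in>Basis. h b y *s b)" for y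
  have T: "Vector_Spaces.linear scale scale T"
    by (simp add: T_def Vector_Spaces.linear_iff vector_space_axioms h_def star_right.add
        star_right.scale lam.add lam.scale scale_left_distrib sum.distrib scale_sum_right)
  have coords: "c b = 0" if "(\<Sum>b\<in>Basis. c b *s b) = 0" "b \<in> Basis" for c b
    using independent_Basis that by (auto simp: dependent_finite finite_Basis)
  have "y = 0" if "T y = 0" for y
  proof (rule h_nondegenerate)
    fix x
    have "lam (x \<star> y) = 0"
    proof (rule lam_star.eq_0_on_span[of Basis])
      show "lam (b \<star> y) = 0" if "b \<in> Basis" for b
        using coords[of "\<lambda>b. h b y" b] that \<open>T y = 0\<close> by (simp add: T_def h_def)
    qed (simp add: span_Basis)
    then show "h y x = 0"
      using h_sym[of x y] by (simp add: h_def)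
  qed
  then have "inj T"
    using module_hom.inj_iff_eq_0[OF module_hom_linearI[OF T]] by blast
  then have "surj T"
    by (rule linear_inj_imp_surj[OF T])
  then obtain v where v: "T v = (\<Sum>b\<in>Basis. lam b *s b)"
    by (metis surjD)
  have diff: "Vector_Spaces.linear scale (*) (\<lambda>x. lam x - lam (x \<star> v))"
    by (simp add: Vector_Spaces.linear_iff vector_space_axioms lam.vs2.vector_space_axioms
        lam.add lam.scale lam_star.add lam_star.scale algebra_simps)
  have "lam x - lam (x \<star> v) = 0" for x
  proof (rule module_hom.eq_0_on_span[OF module_hom_linearI[OF diff], of Basis])
    fix b assume b: "b \<in> Basis"
    have "(\<Sum>b\<in>Basis. (lam b - h b v) *s b) = 0"
      using v by (simp add: T_def scale_left_diff_distrib sum_subtractf)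
    with b show "lam b - lam (b \<star> v) = 0"
      using coords[of "\<lambda>b. lam b - h b v" b] by (simp add: h_def)
  qed (simp add: span_Basis)
  then show ?thesis by auto
qed

section \<open>The idempotent of a Koszul form\<close>

abbreviation u :: 'a where "u \<equiv> associated_idempotent star lam"

text \<open>Nondegeneracy makes the representing vector unique, so the description operator in the
  definition of \<open>u\<close> denotes it.\<close>

lemma lam_eq_h_u: "lam x = h x u"
proof -
  obtain v where v: "\<forall>a. lam a = lam (a \<star> v)"
    using lam_represented by blast
  have "\<forall>a. lam a = lam (a \<star> u)"
    unfolding associated_idempotent_def
  proof (rule theI)
    show "w = v" if "\<forall>a. lam a = lam (a \<star> w)" for w
      by (rule h_eqI) (metis h_def that v)
  qed (rule v)
  then show ?thesis by (simp add: h_def)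
qed

abbreviation R :: "'a \<Rightarrow> 'a" where "R \<equiv> \<lambda>x. x \<star> u"
abbreviation L :: "'a \<Rightarrow> 'a" where "L \<equiv> \<lambda>x. u \<star> x"

text \<open>The Hessian identity at \<open>z = u\<close>, where the left-hand side is the value of \<open>\<lambda>\<close> at a commutator
  and so vanishes.\<close>

lemma R_self_adjoint: "h (R x) y = h x (R y)"
proof -
  have "h x (R y) - h y (R x) = lam (x \<star> y - y \<star> x)"
    by (simp only: hessian[symmetric] lam_eq_h_u)
  then show ?thesis
    by (simp add: lam_commutator h_sym[of y])
qed

lemma R_u: "R u = u"
proof (rule h_eqI)
  fix x
  have "h x (R u) = h (R x) u"
    by (simp add: R_self_adjoint)
  also have "\<dots> = lam (R x)"
    by (simp add: lam_eq_h_u)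
  finally show "h x (R u) = h x u"
    by (simp add: h_def[of x u])
qed

lemma lam_R: "lam (R x) = lam x"
  by (simp add: lam_eq_h_u[of x] h_def)

lemma lam_L: "lam (L x) = lam x"
  by (metis h_def h_sym lam_eq_h_u)

text \<open>The Hessian identity at \<open>y = u\<close>, using \<open>h(u, x \<star> y) = \<lambda>(x \<star> y) = h(x, y)\<close>.\<close>

lemma L_adjoint: "h (L x) y = h x (R y + y - L y)"
proof -
  have "h (R x - L x) y = h x (L y) - h x y"
  proof -
    have "h u (x \<star> y) = h x y"
      using lam_L[of "x \<star> y"] by (simp add: h_def)
    with hessian[of x u y] show ?thesis by simp
  qed
  then have "h (R x) y - h (L x) y = h x (L y) - h x y"
    by (simp add: h_def star_left.diff lam.diff)
  moreover have "h (R x) y = h x (R y)"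
    by (rule R_self_adjoint)
  ultimately show ?thesis
    by (simp add: h_def star_right.diff star_right.add lam.diff lam.add algebra_simps)
qed

lemma adjoint_R: "adjoint_wrt scale h R = R"
  by (rule adjoint_wrt_eqI[OF linear_star_left R_self_adjoint])

lemma adjoint_L: "adjoint_wrt scale h L = (\<lambda>x. R x + x - L x)"
  by (rule adjoint_wrt_eqI[OF _ L_adjoint])
    (simp add: Vector_Spaces.linear_iff vector_space_axioms star_left.add star_left.scale
      star_right.add star_right.scale scale_right_distrib scale_right_diff_distrib)

text \<open>Left symmetry of \<open>u, x, u\<close>, with \<open>u \<star> u = u\<close>. This relation is all that the nilpotency, trace
  and dimension statements need.\<close>

lemma bracket_L_R: "L (R x) - R (L x) = R x - R (R x)"
  using left_symmetric[of u x u] by (simp add: R_u star_left.diff algebra_simps)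

lemma ker_lam_eq_orth_compl: "ker lam = orth_compl h (span {u})"
proof -
  have "h x (c *s u) = c * lam x" for x c
    by (simp add: lam_eq_h_u[of x]) (simp add: h_def star_right.scale lam.scale)
  then show ?thesis
    by (auto simp: ker_def orth_compl_def span_singleton dest: spec[of _ 1])
qed

lemma lie_ideal_ker_lam: "lie_ideal scale (commutator star) (ker lam)"
  unfolding lie_ideal_def commutator_def
  using lam_commutator lam.subspace_kernel by (simp add: ker_def)

lemma lam_R_funpow: "lam ((R ^^ j) x) = lam x"
  by (induction j) (simp_all add: lam_R)

lemma span_ker_R_funpow_subset: "span (\<Union>j\<in>{1..}. ker (R ^^ j)) \<subseteq> ker lam"
proof (rule span_minimal)
  show "subspace (ker lam)"
    by (simp add: ker_def lam.subspace_kernel)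
  show "(\<Union>j\<in>{1..}. ker (R ^^ j)) \<subseteq> ker lam"
  proof (clarsimp simp: ker_def)
    fix j x
    assume "((\<lambda>x. x \<star> u) ^^ j) x = 0"
    then show "lam x = 0"
      using lam_R_funpow[of j x] by simp
  qed
qed

text \<open>For \<open>x\<close> in the ideal, \<open>h(y, x) = \<lambda>(y \<star> x) = 0\<close> for each \<open>y\<close>, since \<open>y \<star> x\<close> is in the ideal as
  well.\<close>

lemma left_ideal_in_ker_lam:
  assumes "left_ideal scale star I" and "I \<subseteq> ker lam"
  shows "I = {0}"
proof -
  have "x = 0" if "x \<in> I" for x
  proof (rule h_nondegenerate)
    fix y
    have "y \<star> x \<in> ker lam"
      using assms that by (auto simp: left_ideal_def)
    then show "h x y = 0"
      using h_sym[of x y] by (simp add: h_def ker_def)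
  qed
  moreover have "0 \<in> I"
    using assms(1) subspace_0 by (auto simp: left_ideal_def)
  ultimately show ?thesis by blast
qed

lemma ker_R_subset_ker_lam: "ker R \<subseteq> ker lam"
proof (clarsimp simp: ker_def)
  fix x assume "R x = 0"
  then show "lam x = 0"
    using lam_R[of x] by simp
qed

lemma ker_R_lie_subalgebra: "lie_subalgebra scale (commutator star) (ker R)"
  by (simp add: lie_subalgebra_def ker_def commutator_def star_left.subspace_kernel
      left_symmetric star_right.zero)

text \<open>Left symmetry reads \<open>u \<star> (x \<star> y) = (u \<star> x) \<star> y - (x \<star> u) \<star> y + x \<star> (u \<star> y)\<close>, and the
  obstruction \<open>(x \<star> u) \<star> y\<close> is zero for \<open>x \<in> ker R\<close>.\<close>

lemma L_derivation: "R x = 0 \<Longrightarrow> L (x \<star> y) = L x \<star> y + x \<star> L y"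
  using left_symmetric[of u x y] by (simp add: star_left.diff algebra_simps)

text \<open>On \<open>ker R\<close> the relation \<open>[L, R] = R - R\<^sup>2\<close> reads \<open>R L x = 0\<close>, so \<open>L\<close> preserves this subspace.\<close>

lemma L_acts_as_derivation_on_ker_R: "acts_as_derivation_on scale (commutator star) (ker R) L"
  unfolding acts_as_derivation_on_def
proof (intro conjI ballI allI)
  show "L x \<in> ker R" if "x \<in> ker R" for x
    using that bracket_L_R[of x] by (simp add: ker_def star_left.zero star_right.zero)
  show "L (commutator star x y) = commutator star (L x) y + commutator star x (L y)"
    if "x \<in> ker R" "y \<in> ker R" for x y
  proof -
    have "L (x \<star> y) = L x \<star> y + x \<star> L y" "L (y \<star> x) = L y \<star> x + y \<star> L x"
      using that by (auto simp only: ker_def mem_Collect_eq intro: L_derivation)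
    then show ?thesis
      by (simp only: commutator_def star_right.diff) (simp add: algebra_simps)
  qed
qed (simp_all add: star_right.add star_right.scale)

lemma u_nonzero:
  assumes "dim (UNIV :: 'a set) \<noteq> 0"
  shows "u \<noteq> 0"
proof
  assume "u = 0"
  then have "lam x = 0" for x
    using lam_eq_h_u[of x] by (simp add: h_def)
  then have "x = 0" for x :: 'a
    using h_nondegenerate[of x] by (simp add: h_def)
  then have "(UNIV :: 'a set) \<subseteq> {0}" by blast
  then have "dim (UNIV :: 'a set) = 0" by (rule dim_eq_0[THEN iffD2])
  with assms show False by blast
qed

end

theorem lemma4p1:
  fixes scale :: "'k::field_char_0 \<Rightarrow> 'a::ab_group_add \<Rightarrow> 'a"
    and Basis :: "'a set"
    and star :: "'a \<Rightarrow> 'a \<Rightarrow> 'a"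
    and lam :: "'a \<Rightarrow> 'k"
    and n :: nat
  assumes "finite_dimensional_vector_space scale Basis"
    and "vector_space.dim scale (UNIV :: 'a set) = n" and "n \<ge> 1"
    and "left_symmetric_algebra scale star"
    and "koszul_form scale star lam"
  defines "h \<equiv> koszul_metric star lam"
    and "u \<equiv> associated_idempotent star lam"
  defines "L \<equiv> lmult star u"
    and "R \<equiv> rmult star u"
  defines "N \<equiv> (\<lambda>x. R x - R (R x))"
    and "A1 \<equiv> (\<Inter>j\<in>{1..}. range (R ^^ j))"
  shows
    "(lie_ideal scale (commutator star) (ker lam) \<and>
      ker lam = orth_compl h (module.span scale {u}) \<and>
      L ` ker lam \<subseteq> ker lam \<and> R ` ker lam \<subseteq> ker lam) \<and>
    (\<forall>x. L x + adjoint_wrt scale h L x = R x + x) \<and>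
    R = adjoint_wrt scale h R \<and>
    ((\<exists>m. N ^^ m = (\<lambda>x. 0)) \<and>
      (\<exists>k::nat. 1 \<le> k \<and> trace_in scale Basis R = of_nat k \<and> vector_space.dim scale A1 = k \<and>
        k \<le> n \<and> N ^^ (max k (n - k)) = (\<lambda>x. 0))) \<and>
    module.span scale (\<Union>j\<in>{1..}. ker (R ^^ j)) \<subseteq> ker lam \<and>
    (\<forall>I. left_ideal scale star I \<and> I \<noteq> {0} \<longrightarrow> \<not> I \<subseteq> ker lam) \<and>
    (ker R \<subseteq> ker lam \<and> lie_subalgebra scale (commutator star) (ker R) \<and>
      acts_as_derivation_on scale (commutator star) (ker R) L)"
proof -
  interpret K: koszul_algebra scale Basis star lam
    using assms(1,4,5) by (simp add: koszul_algebra_def koszul_algebra_axioms_def)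
  have L_eq: "L = (\<lambda>x. star u x)" and R_eq: "R = (\<lambda>x. star x u)"
    by (simp_all add: L_def R_def lmult_def rmult_def)
  interpret B: bracket_pair scale Basis R L
    unfolding L_eq R_eq u_def
    by unfold_locales (rule K.linear_star_left K.linear_star_right K.bracket_L_R)+
  have "1 \<le> K.dim A1"
  proof -
    have "u \<in> A1"
      unfolding A1_def B.range_E_eq_Inter[symmetric]
      by (rule B.fixed_vector_in_range_E) (simp add: R_eq u_def K.R_u)
    moreover have "u \<noteq> 0"
      using K.u_nonzero assms(2,3) unfolding u_def by simp
    ultimately have "K.dim A1 \<noteq> 0"
      by auto
    then show ?thesis by linarith
  qed
  moreover have "K.dim A1 \<le> n"
    using K.dim_subset_UNIV assms(2) by (simp add: K.dimension_def)
  moreover have "trace_in scale Basis R = of_nat (K.dim A1)"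
    by (simp add: B.trace_R_eq_dim A1_def B.range_E_eq_Inter)
  moreover have "N ^^ max (K.dim A1) (n - K.dim A1) = (\<lambda>x. 0)"
    using B.N_funpow_max_eq_0 unfolding assms(2) B.range_E_eq_Inter N_def A1_def .
  ultimately have four: "\<exists>k::nat. 1 \<le> k \<and> trace_in scale Basis R = of_nat k \<and> K.dim A1 = k \<and>
        k \<le> n \<and> N ^^ (max k (n - k)) = (\<lambda>x. 0)"
    by (intro exI[of _ "K.dim A1"]) simp
  show ?thesis
  proof (intro conjI allI impI)
    show "lie_ideal scale (commutator star) (ker lam)"
      by (rule K.lie_ideal_ker_lam)
    show "ker lam = orth_compl h (K.span {u})"
      unfolding h_def u_def by (rule K.ker_lam_eq_orth_compl)
    show "L ` ker lam \<subseteq> ker lam" "R ` ker lam \<subseteq> ker lam"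
      unfolding L_eq R_eq u_def by (auto simp: ker_def K.lam_L K.lam_R)
    show "L x + adjoint_wrt scale h L x = R x + x" for x
      unfolding L_eq R_eq u_def h_def K.adjoint_L by simp
    show "R = adjoint_wrt scale h R"
      unfolding R_eq u_def h_def K.adjoint_R ..
    show "\<exists>m. N ^^ m = (\<lambda>x. 0)"
      using four by blast
    show "\<exists>k::nat. 1 \<le> k \<and> trace_in scale Basis R = of_nat k \<and> K.dim A1 = k \<and>
        k \<le> n \<and> N ^^ (max k (n - k)) = (\<lambda>x. 0)"
      by (rule four)
    show "K.span (\<Union>j\<in>{1..}. ker (R ^^ j)) \<subseteq> ker lam"
      unfolding R_eq u_def by (rule K.span_ker_R_funpow_subset)
    show "\<not> I \<subseteq> ker lam" if "left_ideal scale star I \<and> I \<noteq> {0}" for I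
      using that K.left_ideal_in_ker_lam by blast
    show "ker R \<subseteq> ker lam"
      unfolding R_eq u_def by (rule K.ker_R_subset_ker_lam)
    show "lie_subalgebra scale (commutator star) (ker R)"
      unfolding R_eq u_def by (rule K.ker_R_lie_subalgebra)
    show "acts_as_derivation_on scale (commutator star) (ker R) L"
      unfolding L_eq R_eq u_def by (rule K.L_acts_as_derivation_on_ker_R)
  qed
qed

end
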